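(* For every complex number $q$ with $|q|<1$, $$\sum_{x_1,x_2,x_3\in\mathbb{Z}} q^{x_1^2+x_2^2+2x_3^2+x_1x_3+x_2x_3}=\varphi^2(q)\,\varphi(q^6)+8q^2\,\psi^2(q^2)\,\psi(q^{12})$$ and $$\sum_{x_1,x_2,x_3\in\mathbb{Z}} (-1)^{x_1}q^{x_1^2+x_2^2+2x_3^2+x_1x_3+x_2x_3}=\varphi(q)\,\varphi(-q)\,\varphi(-q^6).$$
   Context: For $|q|<1$, $\varphi(q):=\sum_{n=-\infty}^{\infty}q^{n^2}$ and $\psi(q):=\sum_{n=0}^{\infty}q^{n(n+1)/2}$. The notation $\varphi^2(q)$ means $(\varphi(q))^2$, and similarly for $\psi^2$. The convention $0^0=1$ is used when $q=0$. *)

theory Defs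
  imports "HOL-Analysis.Analysis"
begin

text \<open>Ramanujan's theta functions, meaningful for \<open>norm q < 1\<close>. Exponents are never
  negative, and both \<open>powi\<close> and \<open>^\<close> satisfy \<open>0\<^sup>0 = 1\<close>, the convention used at \<open>q = 0\<close>.\<close>

definition ramanujan_phi :: "complex \<Rightarrow> complex" where
  "ramanujan_phi q = (\<Sum>\<^sub>\<infinity>n::int. q powi (n\<^sup>2))"

definition ramanujan_psi :: "complex \<Rightarrow> complex" where
  "ramanujan_psi q = (\<Sum>n::nat. q ^ (n * (n + 1) div 2))"

definition ternary_form :: "int \<Rightarrow> int \<Rightarrow> int \<Rightarrow> int" where
  "ternary_form x\<^sub>1 x\<^sub>2 x\<^sub>3 = x\<^sub>1\<^sup>2 + x\<^sub>2\<^sup>2 + 2 * x\<^sub>3\<^sup>2 + x\<^sub>1 * x\<^sub>3 + x\<^sub>2 * x\<^sub>3"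

end

theory Submission
  imports Defs
begin

text \<open>
  Since \<open>4 (x\<^sub>1\<^sup>2 + x\<^sub>2\<^sup>2 + 2 x\<^sub>3\<^sup>2 + x\<^sub>1 x\<^sub>3 + x\<^sub>2 x\<^sub>3) = (2 x\<^sub>1 + x\<^sub>3)\<^sup>2 + (2 x\<^sub>2 + x\<^sub>3)\<^sup>2 + 6 x\<^sub>3\<^sup>2\<close>, the form
  becomes diagonal once the parity of \<open>x\<^sub>3\<close> is fixed. With \<open>x\<^sub>3 = 2 k\<close>, \<open>x\<^sub>1 = a - k\<close>, \<open>x\<^sub>2 = b - k\<close> it
  equals \<open>a\<^sup>2 + b\<^sup>2 + 6 k\<^sup>2\<close>, which gives the products of \<open>\<phi>\<close>'s; with \<open>x\<^sub>3 = 2 k + 1\<close> it equals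
  \<open>a (a + 1) + b (b + 1) + 6 k (k + 1) + 2\<close>, and each sum over \<open>\<int>\<close> is \<open>2 \<psi>\<close>. In the signed sum
  the odd part vanishes, because \<open>a \<mapsto> -1 - a\<close> preserves \<open>a (a + 1)\<close> and flips the sign.
\<close>

text \<open>Complex families are summable only if absolutely summable, so both factors have summable
  norms; the product family is then absolutely summable, which justifies iterated summation.\<close>

lemma has_sum_mult_Times:
  fixes f :: "'a \<Rightarrow> complex" and g :: "'b \<Rightarrow> complex"
  assumes f: "(f has_sum a) A" and g: "(g has_sum b) B"
  shows "((\<lambda>(x, y). f x * g y) has_sum (a * b)) (A \<times> B)"
proof (rule has_sum_SigmaI)
  show "((\<lambda>y. case (x, y) of (x, y) \<Rightarrow> f x * g y) has_sum f x * b) B" for x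
    using has_sum_cmult_right[OF g] by simp
  show "((\<lambda>x. f x * b) has_sum a * b) A"
    by (rule has_sum_cmult_left[OF f])
  have f_abs: "(\<lambda>x. norm (f x)) summable_on A" and g_abs: "(\<lambda>y. norm (g y)) summable_on B"
    using f g by (simp_all only: has_sum_imp_summable flip: summable_on_iff_abs_summable_on_complex)
  have "(\<lambda>p. norm (case p of (x, y) \<Rightarrow> f x * g y)) summable_on A \<times> B"
    unfolding Infinite_Sum.abs_summable_on_Sigma_iff
  proof (intro conjI ballI)
    show "(\<lambda>y. norm (case (x, y) of (x, y) \<Rightarrow> f x * g y)) summable_on B" for x
      using summable_on_cmult_right[OF g_abs] by (simp add: norm_mult)
    have "(\<lambda>x. norm (f x) * \<bar>\<Sum>\<^sub>\<infinity>y\<in>B. norm (g y)\<bar>) summable_on A"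
      by (rule summable_on_cmult_left[OF f_abs])
    then show "(\<lambda>x. norm (\<Sum>\<^sub>\<infinity>y\<in>B. norm (case (x, y) of (x, y) \<Rightarrow> f x * g y))) summable_on A"
      by (simp add: norm_mult abs_mult infsum_cmult_right' infsum_nonneg)
  qed
  then show "(\<lambda>(x, y). f x * g y) summable_on A \<times> B"
    by (rule abs_summable_summable)
qed

text \<open>The reflection n -> -1 - n exchanges the nonnegative and the negative integers. Unlike n
  -> -n it has no fixed point, so nothing is counted twice, and it preserves n (n + 1).\<close>

lemma has_sum_int_reflect:
  fixes g :: "int \<Rightarrow> 'a :: topological_comm_monoid_add"
  assumes "((\<lambda>n. g (int n)) has_sum a) UNIV" and "((\<lambda>n. g (- 1 - int n)) has_sum b) UNIV"
  shows "(g has_sum (a + b)) UNIV"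
proof -
  have "(g has_sum a) (range int)"
    using assms(1) by (subst has_sum_reindex) (auto simp: o_def inj_on_def)
  moreover have "(g has_sum b) (range (\<lambda>n. - 1 - int n))"
    using assms(2) by (subst has_sum_reindex) (auto simp: o_def inj_on_def)
  moreover have "range int \<inter> range (\<lambda>n. - 1 - int n) = {}"
    by auto
  ultimately have "(g has_sum (a + b)) (range int \<union> range (\<lambda>n. - 1 - int n))"
    by (rule has_sum_Un_disjoint)
  also have "range int \<union> range (\<lambda>n. - 1 - int n) = UNIV"
  proof -
    have "x \<in> range int \<union> range (\<lambda>n. - 1 - int n)" for x
      using rangeI[of int "nat x"] rangeI[of "\<lambda>n. - 1 - int n" "nat (- 1 - x)"]
      by (cases "x \<ge> 0") auto
    then show ?thesis by blast
  qed
  finally show ?thesis .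
qed

text \<open>Comparison with the geometric series of \<open>norm q\<close>. The bound on
  \<open>e\<close> covers the exponents n^2, (n + 1)^2 and n (n + 1) used below.\<close>

lemma summable_norm_power_comp:
  fixes q :: "'a :: real_normed_div_algebra"
  assumes "norm q < 1" and "\<And>n. n \<le> e n"
  shows "summable (\<lambda>n. norm (q ^ e n))"
proof (rule summable_comparison_test')
  show "summable (\<lambda>n. norm q ^ n)"
    using assms(1) by (intro summable_geometric) simp
  show "norm (norm (q ^ e n)) \<le> norm q ^ n" for n
    using power_decreasing[OF assms(2), of "norm q"] assms(1) by (simp add: norm_power)
qed

lemma has_sum_power_comp:
  fixes q :: "'a :: {real_normed_div_algebra, banach}"
  assumes "norm q < 1" and "\<And>n. n \<le> e n"
  shows "((\<lambda>n. q ^ e n) has_sum (\<Sum>n. q ^ e n)) UNIV"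
proof (rule norm_summable_imp_has_sum)
  show "summable (\<lambda>n. norm (q ^ e n))"
    using assms by (rule summable_norm_power_comp)
  then show "(\<lambda>n. q ^ e n) sums (\<Sum>n. q ^ e n)"
    by (rule summable_sums[OF summable_norm_cancel])
qed

lemma has_sum_ramanujan_phi:
  assumes "norm q < 1"
  shows "((\<lambda>n::int. q powi n\<^sup>2) has_sum ramanujan_phi q) UNIV"
proof -
  have "(int n)\<^sup>2 = int (n\<^sup>2)" and "(- 1 - int n)\<^sup>2 = int ((n + 1)\<^sup>2)" for n
    by (simp_all add: power2_eq_square algebra_simps)
  then have "((\<lambda>n. q powi (int n)\<^sup>2) has_sum (\<Sum>n. q ^ n\<^sup>2)) UNIV"
    and "((\<lambda>n. q powi (- 1 - int n)\<^sup>2) has_sum (\<Sum>n. q ^ (n + 1)\<^sup>2)) UNIV"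
    using has_sum_power_comp[OF assms, of "\<lambda>n. n\<^sup>2"]
      has_sum_power_comp[OF assms, of "\<lambda>n. (n + 1)\<^sup>2"]
    by (simp_all only: power_int_of_nat) (simp_all add: power2_eq_square)
  \<comment> \<open>Only summability is extracted from the two halves, since
    \<open>ramanujan_phi\<close> is by definition the infinite sum over the integers.\<close>
  then show ?thesis
    unfolding ramanujan_phi_def
    by (intro has_sum_infsum has_sum_imp_summable[OF has_sum_int_reflect])
qed

text \<open>Taking \<open>q\<^sup>2\<close> as argument cancels the halving in the triangular
  exponent of \<open>ramanujan_psi\<close>.\<close>

lemma has_sum_ramanujan_psi:
  assumes "norm q < 1"
  shows "((\<lambda>n. q ^ (n * (n + 1))) has_sum ramanujan_psi (q\<^sup>2)) UNIV"
proof -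
  have "(q\<^sup>2) ^ (n * (n + 1) div 2) = q ^ (n * (n + 1))" for n
    by (simp flip: power_mult)
  then show ?thesis
    using has_sum_power_comp[OF assms, of "\<lambda>n. n * (n + 1)"] by (simp add: ramanujan_psi_def)
qed

lemma has_sum_int_ramanujan_psi:
  assumes "norm q < 1"
  shows "((\<lambda>n::int. q powi (n * (n + 1))) has_sum 2 * ramanujan_psi (q\<^sup>2)) UNIV"
proof -
  have "int n * (int n + 1) = int (n * (n + 1))"
    and "(- 1 - int n) * (- 1 - int n + 1) = int (n * (n + 1))" for n
    by (simp_all add: algebra_simps)
  then have "((\<lambda>n. q powi (int n * (int n + 1))) has_sum ramanujan_psi (q\<^sup>2)) UNIV"
    and "((\<lambda>n. q powi ((- 1 - int n) * (- 1 - int n + 1))) has_sum ramanujan_psi (q\<^sup>2)) UNIV"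
    using has_sum_ramanujan_psi[OF assms] by (simp_all only: power_int_of_nat)
  from has_sum_int_reflect[OF this] show ?thesis
    by simp
qed

lemma has_sum_int_alternating:
  assumes "norm q < 1"
  shows "((\<lambda>n::int. (- 1) powi n * q powi (n * (n + 1))) has_sum (0::complex)) UNIV"
proof -
  let ?g = "\<lambda>n::int. (- 1) powi n * q powi (n * (n + 1))"
  have "(\<lambda>n. ?g (int n)) summable_on UNIV"
  proof (rule norm_summable_imp_summable_on)
    have "int n * (int n + 1) = int (n * (n + 1))" for n
      by (simp add: algebra_simps)
    then have "norm (?g (int n)) = norm (q ^ (n * (n + 1)))" for n
      by (simp only: power_int_of_nat norm_mult) (simp add: norm_power)
    then show "summable (\<lambda>n. norm (?g (int n)))"
      using summable_norm_power_comp[OF assms, of "\<lambda>n. n * (n + 1)"] by simp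
  qed
  \<comment> \<open>The value of \<open>S\<close> stays unknown: the negative half contributes
    \<open>- S\<close>.\<close>
  then obtain S where S: "((\<lambda>n. ?g (int n)) has_sum S) UNIV"
    by (auto simp: summable_on_def)
  have "?g (- 1 - int n) = - ?g (int n)" for n
    by (cases "even n") (simp_all add: algebra_simps)
  then have "((\<lambda>n. ?g (- 1 - int n)) has_sum - S) UNIV"
    using S by (simp add: has_sum_uminus)
  from has_sum_int_reflect[OF S this] show ?thesis
    by simp
qed

text \<open>Each substitution is a bijection from all integer triples onto those whose third entry
  has the given parity. Since \<open>div\<close> rounds down, \<open>z div 2\<close> recovers
  \<open>k\<close> in both cases, also for negative \<open>z\<close>.\<close>

lemma has_sum_split_parity:
  fixes F :: "int \<times> int \<times> int \<Rightarrow> 'a :: topological_comm_monoid_add"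
  assumes even: "((\<lambda>(a, b, k). F (a - k, b - k, 2 * k)) has_sum A) UNIV"
    and odd: "((\<lambda>(a, b, k). F (a - k, b - k, 2 * k + 1)) has_sum B) UNIV"
  shows "(F has_sum (A + B)) UNIV"
proof -
  have "((\<lambda>(a, b, k). F (a - k, b - k, 2 * k)) has_sum A) UNIV \<longleftrightarrow>
        (F has_sum A) {(x, y, z). even z}"
    by (rule has_sum_reindex_bij_witness
        [where i = "\<lambda>(x, y, z). (x + z div 2, y + z div 2, z div 2)"
          and j = "\<lambda>(a, b, k). (a - k, b - k, 2 * k)"]) auto
  moreover have "((\<lambda>(a, b, k). F (a - k, b - k, 2 * k + 1)) has_sum B) UNIV \<longleftrightarrow>
        (F has_sum B) {(x, y, z). odd z}"
    by (rule has_sum_reindex_bij_witness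
        [where i = "\<lambda>(x, y, z). (x + z div 2, y + z div 2, z div 2)"
          and j = "\<lambda>(a, b, k). (a - k, b - k, 2 * k + 1)"]) auto
  ultimately have "(F has_sum (A + B)) ({(x, y, z). even z} \<union> {(x, y, z). odd z})"
    using even odd by (intro has_sum_Un_disjoint) auto
  also have "{(x, y, z). even z} \<union> {(x, y, z). odd z} = (UNIV :: (int \<times> int \<times> int) set)"
    by auto
  finally show ?thesis .
qed

text \<open>Nonnegative exponents make the addition law hold at \<open>q = 0\<close> too, where it
  fails for exponents 1 and -1.\<close>

lemma power_int_add_nonneg:
  fixes q :: "'a :: division_ring"
  assumes "m \<ge> 0" and "n \<ge> 0"
  shows "q powi (m + n) = q powi m * q powi n"
  using assms by (simp add: power_int_def nat_add_distrib power_add)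

lemma zero_le_mult_Suc_int: "(n::int) * (n + 1) \<ge> 0"
  by (cases "n \<ge> 0") (auto simp: zero_le_mult_iff)

lemma ternary_form_even: "ternary_form (a - k) (b - k) (2 * k) = a\<^sup>2 + (b\<^sup>2 + 6 * k\<^sup>2)"
  by (simp add: ternary_form_def power2_eq_square algebra_simps)

lemma ternary_form_odd:
  "ternary_form (a - k) (b - k) (2 * k + 1) = 2 + (a * (a + 1) + (b * (b + 1) + 6 * (k * (k + 1))))"
  by (simp add: ternary_form_def power2_eq_square algebra_simps)

lemma powi_ternary_form_even:
  fixes q :: complex
  shows "q powi ternary_form (a - k) (b - k) (2 * k) = q powi a\<^sup>2 * (q powi b\<^sup>2 * (q ^ 6) powi k\<^sup>2)"
  unfolding ternary_form_even by (simp add: power_int_add_nonneg power_int_power)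

lemma powi_ternary_form_odd:
  fixes q :: complex
  shows "q powi ternary_form (a - k) (b - k) (2 * k + 1) =
    q\<^sup>2 * (q powi (a * (a + 1)) * (q powi (b * (b + 1)) * (q ^ 6) powi (k * (k + 1))))"
proof -
  have "6 * (k * (k + 1)) \<ge> 0"
    using zero_le_mult_Suc_int[of k] by linarith
  then show ?thesis
    unfolding ternary_form_odd
    by (simp add: power_int_add_nonneg power_int_power zero_le_mult_Suc_int)
qed

text \<open>The square of \<open>n\<close> has the parity of \<open>n\<close>.\<close>

lemma minus_powi_square: "(- q) powi (n\<^sup>2) = (- 1) powi n * (q :: complex) powi (n\<^sup>2)"
  by (cases "even n") simp_all


theorem corollary4p1:
  fixes q :: complex
  assumes "norm q < 1"
  shows "((\<lambda>(x\<^sub>1, x\<^sub>2, x\<^sub>3). q powi ternary_form x\<^sub>1 x\<^sub>2 x\<^sub>3) has_sum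
            ((ramanujan_phi q)\<^sup>2 * ramanujan_phi (q ^ 6)
              + 8 * q\<^sup>2 * (ramanujan_psi (q\<^sup>2))\<^sup>2 * ramanujan_psi (q ^ 12)))
          (UNIV :: (int \<times> int \<times> int) set)
    \<and> ((\<lambda>(x\<^sub>1, x\<^sub>2, x\<^sub>3). (-1) powi x\<^sub>1 * q powi ternary_form x\<^sub>1 x\<^sub>2 x\<^sub>3) has_sum
            (ramanujan_phi q * ramanujan_phi (- q) * ramanujan_phi (- (q ^ 6))))
          (UNIV :: (int \<times> int \<times> int) set)"
proof -
  have q6: "norm (q ^ 6) < 1"
    using assms by (simp add: norm_power power_less_one_iff)
  note phi = has_sum_ramanujan_phi[OF assms]
  note psi = has_sum_int_ramanujan_psi[OF assms]
  note has_sum_mult_Times3 = has_sum_mult_Times[OF _ has_sum_mult_Times, unfolded UNIV_Times_UNIV]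
  have "((\<lambda>(a, b, k). q powi ternary_form (a - k) (b - k) (2 * k)) has_sum
      (ramanujan_phi q)\<^sup>2 * ramanujan_phi (q ^ 6)) UNIV"
    using has_sum_mult_Times3[OF phi phi has_sum_ramanujan_phi[OF q6]]
    by (simp add: powi_ternary_form_even case_prod_unfold power2_eq_square mult.assoc)
  moreover have "((\<lambda>(a, b, k). q powi ternary_form (a - k) (b - k) (2 * k + 1)) has_sum
      8 * q\<^sup>2 * (ramanujan_psi (q\<^sup>2))\<^sup>2 * ramanujan_psi (q ^ 12)) UNIV"
    \<comment> \<open>The 8 collects a factor 2 from each of the three sums, and
      \<open>q ^ 12\<close> is the square of \<open>q ^ 6\<close>.\<close>
    using has_sum_cmult_right[OF has_sum_mult_Times3[OF psi psi has_sum_int_ramanujan_psi[OF q6]],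
        of "q\<^sup>2"]
    by (simp add: powi_ternary_form_odd case_prod_unfold power2_eq_square mult_ac
        flip: power_mult)
  ultimately have unsigned: "((\<lambda>(x\<^sub>1, x\<^sub>2, x\<^sub>3). q powi ternary_form x\<^sub>1 x\<^sub>2 x\<^sub>3) has_sum
      ((ramanujan_phi q)\<^sup>2 * ramanujan_phi (q ^ 6)
        + 8 * q\<^sup>2 * (ramanujan_psi (q\<^sup>2))\<^sup>2 * ramanujan_psi (q ^ 12))) UNIV"
    by (intro has_sum_split_parity) simp_all
  \<comment> \<open>The sign falls on the sums over \<open>a\<close> and \<open>k\<close> only, so
    in the even part these become \<phi>(-q) and \<phi>(-q^6), while the sum over \<open>b\<close>
    remains \<phi>(q).\<close>
  have sign: "(- 1) powi (a - k) = (- 1) powi a * ((- 1) powi k :: complex)" for a k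
    by (cases "even a"; cases "even k") simp_all
  have "((\<lambda>(a, b, k). (- 1) powi (a - k) * q powi ternary_form (a - k) (b - k) (2 * k)) has_sum
      ramanujan_phi q * ramanujan_phi (- q) * ramanujan_phi (- (q ^ 6))) UNIV"
    using has_sum_mult_Times3[OF has_sum_ramanujan_phi[of "- q"] phi
        has_sum_ramanujan_phi[of "- (q ^ 6)"]] assms q6
    by (simp add: powi_ternary_form_even case_prod_unfold minus_powi_square sign mult_ac)
  moreover have "((\<lambda>(a, b, k). (- 1) powi (a - k) *
      q powi ternary_form (a - k) (b - k) (2 * k + 1)) has_sum 0) UNIV"
    using has_sum_cmult_right[OF has_sum_mult_Times3[OF has_sum_int_alternating[OF assms] psi
        has_sum_int_alternating[OF q6]], of "q\<^sup>2"]
    by (simp add: powi_ternary_form_odd case_prod_unfold sign mult_ac)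
  ultimately have "((\<lambda>(x\<^sub>1, x\<^sub>2, x\<^sub>3). (- 1) powi x\<^sub>1 * q powi ternary_form x\<^sub>1 x\<^sub>2 x\<^sub>3) has_sum
      (ramanujan_phi q * ramanujan_phi (- q) * ramanujan_phi (- (q ^ 6)) + 0)) UNIV"
    by (intro has_sum_split_parity) simp_all
  with unsigned show ?thesis
    by simp
qed

end
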